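(* Let $\lambda_0\ge\lambda_1\ge\dots\ge\lambda_{2m+1}$ be real numbers, and let $a_1\ge\dots\ge a_m$ and $a_0$ be nonnegative real numbers, satisfying all of the following conditions: (1) $a_i\ge\lambda_{2i-1}$ for $i=1,\dots,m$; (2) $\displaystyle\sum_{i=0}^{k}\lambda_i\ge\sum_{i=1}^{\lceil (k+1)/2\rceil}a_i+\sum_{i=1}^{\lfloor (k+1)/2\rfloor}a_i$ for $k=1,\dots,2m-1$; (3) $\displaystyle\sum_{i=0}^{2m+1}\lambda_i=2\sum_{i=0}^{m}a_i$. Then there is a $(2m+2)\times(2m+2)$ nonnegative bisymmetric matrix with eigenvalues (counted with multiplicity) $\lambda_0,\dots,\lambda_{2m+1}$ and with diagonal entries, in order, $a_m,a_{m-1},\dots,a_1,a_0,a_0,a_1,\dots,a_m$.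
   Context: All matrices are real. A square matrix $Q$ is bisymmetric if $Q^T=Q$ and $JQJ=Q$, where $J$ is the reverse identity matrix (ones on the anti-diagonal, zeros elsewhere). A matrix is nonnegative if all its entries are $\ge 0$. *)

theory Defs
  imports "Jordan_Normal_Form.Char_Poly"
begin

definition reverse_identity_mat :: "nat \<Rightarrow> real mat" where
  "reverse_identity_mat n = mat n n (\<lambda>(i, j). if i + j + 1 = n then 1 else 0)"

definition bisymmetric_mat :: "real mat \<Rightarrow> bool" where
  "bisymmetric_mat Q \<longleftrightarrow> square_mat Q \<and> transpose_mat Q = Q \<and>
     reverse_identity_mat (dim_row Q) * Q * reverse_identity_mat (dim_row Q) = Q"

definition nonnegative_mat :: "real mat \<Rightarrow> bool" where
  "nonnegative_mat Q \<longleftrightarrow> (\<forall>x \<in> elements_mat Q. 0 \<le> x)"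

(* The list contains every eigenvalue as often as its algebraic multiplicity, in any order;
   in particular all complex eigenvalues of the matrix are real. *)
definition has_eigenvalues :: "real mat \<Rightarrow> real list \<Rightarrow> bool" where
  "has_eigenvalues Q xs \<longleftrightarrow> square_mat Q \<and> char_poly Q = (\<Prod>x\<leftarrow>xs. [:- x, 1:])"

end

theory Submission
  imports Defs
begin

text \<open>
  In a basis of symmetric and antisymmetric vectors, a bisymmetric matrix of even order splits
  into two symmetric blocks \<open>M\<close> and \<open>N\<close>; it is nonnegative iff \<open>\<bar>N\<bar> \<le> M\<close> entrywise, and its
  diagonal is that of \<open>(M + N) / 2\<close>. Take \<open>N\<close> diagonal with entries
  \<open>\<nu>\<^sub>i = \<lambda>\<^bsub>2i-1\<^esub> \<le> a\<^sub>i\<close> and \<open>\<nu>\<^sub>0 = \<lambda>\<^bsub>2m+1\<^esub> \<le> a\<^sub>0\<close>. Then \<open>M\<close> must be nonnegative with diagonal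
  \<open>d\<^sub>i = 2 a\<^sub>i - \<nu>\<^sub>i\<close> and eigenvalues \<open>e\<^sub>i = \<lambda>\<^bsub>2i\<^esub>\<close>. Following Fiedler, it is built from the \<open>1 \<times> 1\<close>
  matrix \<open>d\<^sub>0\<close> by bordering it successively with \<open>d\<^sub>m, \<dots>, d\<^sub>1\<close> along a nonnegative eigenvector,
  each step splitting the eigenvalue \<open>e\<^sub>k\<close> off the trace. A step needs \<open>e\<^sub>k \<le> d\<^sub>k\<close> and that \<open>e\<^sub>k\<close>
  does not exceed the current Perron root, which are conditions (1) and (2).
\<close>

section \<open>Spectra from orthonormal eigenvectors\<close>

text \<open>The first argument of \<open>V\<close> selects the eigenvector, the second its
  coordinate. Functions on an index set, rather than matrices, let indices be adjoined in any
  order.\<close>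

definition eigenbasis ::
  "'a set \<Rightarrow> ('a \<Rightarrow> 'a \<Rightarrow> real) \<Rightarrow> ('a \<Rightarrow> real) \<Rightarrow> ('a \<Rightarrow> 'a \<Rightarrow> real) \<Rightarrow> bool" where
  "eigenbasis I M w V \<longleftrightarrow>
     (\<forall>i\<in>I. \<forall>j\<in>I. (\<Sum>x\<in>I. V i x * V j x) = of_bool (i = j)) \<and>
     (\<forall>j\<in>I. \<forall>x\<in>I. (\<Sum>y\<in>I. M x y * V j y) = w j * V j x)"

text \<open>With the eigenvectors as rows of an orthogonal \<open>U\<close>, the matrix is similar
  to the diagonal matrix of the \<open>w i\<close>, whose characteristic polynomial is
  immediate.\<close>

lemma char_poly_eigenbasis:
  fixes M :: "nat \<Rightarrow> nat \<Rightarrow> real"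
  assumes "eigenbasis {..<n} M w V"
  shows "char_poly (mat n n (\<lambda>(i, j). M i j)) = (\<Prod>i<n. [:- w i, 1:])"
proof -
  define A where "A = mat n n (\<lambda>(i, j). M i j)"
  define U where "U = mat n n (\<lambda>(i, j). V i j)"
  define D where "D = mat n n (\<lambda>(i, j). if i = j then w i else 0)"
  have [simp]: "A \<in> carrier_mat n n" "U \<in> carrier_mat n n" "D \<in> carrier_mat n n"
    by (auto simp: A_def U_def D_def)
  have UUT: "U * U\<^sup>T = 1\<^sub>m n"
    using assms by (intro eq_matI)
      (auto simp: U_def scalar_prod_def eigenbasis_def lessThan_atLeast0)
  \<comment> \<open>For a square matrix, orthonormal rows force orthonormal columns.\<close>
  then have UTU: "U\<^sup>T * U = 1\<^sub>m n"
    by (intro mat_mult_left_right_inverse[of U n]) auto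
  have "(\<Sum>k<n. V k i * (if k = j then w k else 0)) = w j * V j i" if "j < n" for i j
    using that by (subst sum.remove[of _ j]) (auto intro!: sum.neutral)
  then have "A * U\<^sup>T = U\<^sup>T * D"
    using assms by (intro eq_matI)
      (auto simp: A_def U_def D_def scalar_prod_def eigenbasis_def lessThan_atLeast0)
  then have "A * (U\<^sup>T * U) = U\<^sup>T * D * U"
    by (subst assoc_mult_mat[symmetric, of _ n n _ n _ n]) auto
  then have "A = U\<^sup>T * D * U"
    by (simp add: UTU right_mult_one_mat[of A n n])
  then have "similar_mat A D"
    unfolding similar_mat_def similar_mat_wit_def Let_def
    using UUT UTU by (intro exI[of _ "U\<^sup>T"] exI[of _ U]) (auto simp: A_def U_def D_def)
  then have "char_poly A = char_poly D"
    by (rule char_poly_similar)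
  also have "\<dots> = (\<Prod>a\<leftarrow>diag_mat D. [:- a, 1:])"
    by (rule char_poly_upper_triangular[of _ n]) (auto simp: D_def)
  also have "\<dots> = (\<Prod>i<n. [:- w i, 1:])"
  proof -
    have "diag_mat D = map w [0..<n]"
      by (auto simp: diag_mat_def D_def)
    then show ?thesis
      by (simp add: prod.distinct_set_conv_list[symmetric] comp_def lessThan_atLeast0)
  qed
  finally show ?thesis
    by (simp add: A_def)
qed

section \<open>Nonnegative symmetric matrices with prescribed spectrum and diagonal\<close>

text \<open>The index \<open>p\<close> marks the eigenvector along which the matrix gets bordered;
  its nonnegativity keeps the new row and column nonnegative.\<close>

definition perron_system ::
  "'a set \<Rightarrow> 'a \<Rightarrow> ('a \<Rightarrow> 'a \<Rightarrow> real) \<Rightarrow> ('a \<Rightarrow> real) \<Rightarrow> ('a \<Rightarrow> 'a \<Rightarrow> real) \<Rightarrow> bool" where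
  "perron_system I p M w V \<longleftrightarrow>
     (\<forall>x\<in>I. \<forall>y\<in>I. M x y = M y x \<and> 0 \<le> M x y) \<and> (\<forall>x\<in>I. 0 \<le> V p x) \<and> eigenbasis I M w V"

text \<open>The matrix with diagonal \<open>s\<close>, \<open>d\<close> and off-diagonal entry
  \<open>c\<close> is sought as \<open>e\<close> times the identity plus \<open>t\<close> times the
  projection onto the unit vector \<open>(u, v)\<close>. Then \<open>(u, v)\<close> has eigenvalue
  \<open>s + d - e\<close> and \<open>(-v, u)\<close> has eigenvalue \<open>e\<close>.\<close>

lemma two_by_two_eigenvectors:
  fixes s d e :: real
  assumes "e \<le> s" "e \<le> d"
  obtains c u v where "0 \<le> c" "0 \<le> u" "0 \<le> v" "u * u + v * v = 1"
    "s * u + c * v = (s + d - e) * u" "c * u + d * v = (s + d - e) * v"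
    "c * u - s * v = - e * v" "d * u - c * v = e * u"
proof -
  \<comment> \<open>The gap between the two eigenvalues; if it is zero, the matrix is scalar and any
    unit vector serves.\<close>
  define t where "t = s - e + (d - e)"
  obtain u v where uv: "0 \<le> u" "0 \<le> v" "u * u + v * v = 1" "s = e + t * (u * u)" "d = e + t * (v * v)"
  proof (cases "t = 0")
    case True
    then have "s = e" "d = e"
      using assms by (auto simp: t_def)
    then show ?thesis
      using that[of 1 0] True by simp
  next
    case False
    then have "t > 0"
      using assms by (auto simp: t_def)
    then show ?thesis
      using assms by (intro that[of "sqrt ((s - e) / t)" "sqrt ((d - e) / t)"])
        (auto simp: t_def divide_simps)
  qed
  have t: "0 \<le> t"
    using assms by (simp add: t_def)
  show ?thesis
  proof (rule that[of "t * (u * v)" u v])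
    have "s * u + t * (u * v) * v = e * u + t * u * (u * u + v * v)"
      by (simp add: uv(4) algebra_simps)
    then show "s * u + t * (u * v) * v = (s + d - e) * u"
      unfolding uv(3) by (simp add: t_def algebra_simps)
    have "t * (u * v) * u + d * v = e * v + t * v * (u * u + v * v)"
      by (simp add: uv(5) algebra_simps)
    then show "t * (u * v) * u + d * v = (s + d - e) * v"
      unfolding uv(3) by (simp add: t_def algebra_simps)
    show "t * (u * v) * u - s * v = - e * v"
      by (simp add: uv(4) algebra_simps)
    show "d * u - t * (u * v) * v = e * u"
      by (simp add: uv(5) algebra_simps)
  qed (use uv t in auto)
qed

text \<open>The new row is \<open>c\<close> times \<open>V p\<close>, with corner \<open>d\<close>.
  Every other eigenvector is orthogonal to \<open>V p\<close>, so it stays one when extended by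
  zero. On the span of \<open>V p\<close> and the new unit vector, the matrix acts as the two-by-two
  matrix with diagonal \<open>w p\<close>, \<open>d\<close>.\<close>

lemma perron_system_insert:
  assumes fin: "finite I" and p: "p \<in> I" and k: "k \<notin> I"
    and sys: "perron_system I p M w V"
    and e: "e \<le> w p" "e \<le> d" and d: "0 \<le> d"
  obtains M' V' where "perron_system (insert k I) p M' (w(p := w p + d - e, k := e)) V'"
    "M' k k = d" "\<And>x. x \<in> I \<Longrightarrow> M' x x = M x x"
proof -
  obtain c u v where c: "0 \<le> c" "0 \<le> u" "0 \<le> v" "u * u + v * v = 1"
    "s = w p \<Longrightarrow> s * u + c * v = (s + d - e) * u" "c * u + d * v = (w p + d - e) * v"
    "c * u - w p * v = - e * v" "d * u - c * v = e * u" for s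
    using two_by_two_eigenvectors[OF e] by metis
  have sym: "M x y = M y x" "0 \<le> M x y" "0 \<le> V p x" if "x \<in> I" "y \<in> I" for x y
    using sys that by (auto simp: perron_system_def)
  have orth: "(\<Sum>x\<in>I. V i x * V j x) = of_bool (i = j)" if "i \<in> I" "j \<in> I" for i j
    using sys that unfolding perron_system_def eigenbasis_def by blast
  have eig: "(\<Sum>y\<in>I. M x y * V j y) = w j * V j x" if "j \<in> I" "x \<in> I" for j x
    using sys that unfolding perron_system_def eigenbasis_def by blast
  define M' where "M' x y = (if x = k then if y = k then d else c * V p y
    else if y = k then c * V p x else M x y)" for x y
  \<comment> \<open>Eigenvector \<open>j\<close> of the new matrix is \<open>al j\<close> times the
    old vector \<open>r j\<close>, with coordinate \<open>be j\<close> at \<open>k\<close>. Index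
    \<open>p\<close> gets the combination \<open>(u, v)\<close> and \<open>k\<close> gets
    \<open>(-v, u)\<close>, both built on the old \<open>V p\<close>.\<close>
  define al where "al j = (if j = k then - v else if j = p then u else 1)" for j
  define be where "be j = (if j = k then u else if j = p then v else 0)" for j
  define r where "r j = (if j = k then p else j)" for j
  define V' where "V' j x = (if x = k then be j else al j * V (r j) x)" for j x
  have pk: "p \<noteq> k" using p k by auto
  have rI: "r j \<in> I" if "j \<in> insert k I" for j
    using that p by (auto simp: r_def)
  have sumV: "(\<Sum>x\<in>I. f x * V' j x) = al j * (\<Sum>x\<in>I. f x * V (r j) x)" for f j
    unfolding sum_distrib_left by (rule sum.cong) (use k in \<open>auto simp: V'_def\<close>)
  have sumVV: "(\<Sum>x\<in>I. V' i x * V' j x) = al i * al j * (\<Sum>x\<in>I. V (r i) x * V (r j) x)" for i j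
    unfolding sum_distrib_left by (rule sum.cong) (use k in \<open>auto simp: V'_def\<close>)
  have sumM: "(\<Sum>y\<in>I. M' x y * f y) =
      (if x = k then c * (\<Sum>y\<in>I. V p y * f y) else (\<Sum>y\<in>I. M x y * f y))" for x f
    unfolding sum_distrib_left using k
    by (auto simp: M'_def intro!: sum.cong)
  have "(\<Sum>x\<in>insert k I. V' i x * V' j x) = of_bool (i = j)"
    if "i \<in> insert k I" "j \<in> insert k I" for i j
  proof -
    have "(\<Sum>x\<in>insert k I. V' i x * V' j x) = be i * be j + al i * al j * of_bool (r i = r j)"
      using fin k by (simp add: sumVV orth[OF rI[OF that(1)] rI[OF that(2)]]) (simp add: V'_def)
    also have "\<dots> = of_bool (i = j)"
      using that k pk c(4) by (auto simp: al_def be_def r_def algebra_simps)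
    finally show ?thesis .
  qed
  moreover have "(\<Sum>y\<in>insert k I. M' x y * V' j y) = (w(p := w p + d - e, k := e)) j * V' j x"
    if j: "j \<in> insert k I" and x: "x \<in> insert k I" for j x
  proof -
    have "(\<Sum>y\<in>insert k I. M' x y * V' j y) = M' x k * be j + (\<Sum>y\<in>I. M' x y * V' j y)"
      using fin k by (simp add: V'_def)
    also have "(\<Sum>y\<in>I. M' x y * V' j y) = al j *
      (if x = k then c * of_bool (p = r j) else w (r j) * V (r j) x)"
      using x by (auto simp: sumV sumM orth[OF p rI[OF j]] eig[OF rI[OF j]])
    also have "M' x k * be j + \<dots> = (w(p := w p + d - e, k := e)) j * V' j x"
    proof (cases "x = k")
      case True
      then show ?thesis
        using c(6,8) pk by (auto simp: al_def be_def r_def V'_def M'_def algebra_simps)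
    next
      case False
      have "c * V p x * v + u * (w p * V p x) = (w p * u + c * v) * V p x"
        by (simp add: algebra_simps)
      also have "\<dots> = (w p + d - e) * u * V p x"
        by (simp add: c(5))
      finally have 1: "c * V p x * v + u * (w p * V p x) = (w p + d - e) * u * V p x" .
      have "c * V p x * u - v * (w p * V p x) = (c * u - w p * v) * V p x"
        by (simp add: algebra_simps)
      then have 2: "c * V p x * u - v * (w p * V p x) = - (e * v * V p x)"
        by (simp add: c(7))
      show ?thesis
        using False 1 2 pk by (auto simp: al_def be_def r_def V'_def M'_def)
    qed
    finally show ?thesis .
  qed
  moreover have "M' x y = M' y x \<and> 0 \<le> M' x y" if "x \<in> insert k I" "y \<in> insert k I" for x y
    using that d c(1) sym by (auto simp: M'_def)
  moreover have "0 \<le> V' p x" if "x \<in> insert k I" for x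
    using that pk c(2,3) sym p by (auto simp: V'_def al_def be_def r_def)
  ultimately have "perron_system (insert k I) p M' (w(p := w p + d - e, k := e)) V'"
    unfolding perron_system_def eigenbasis_def by blast
  then show ?thesis
    by (rule that) (use k in \<open>auto simp: M'_def\<close>)
qed

text \<open>Downward induction on \<open>k\<close> borders by \<open>d m\<close>, ...,
  \<open>d 1\<close>. The Perron root is fixed by the trace, and the partial sum conditions keep it
  at least as large as the next eigenvalue to split off.\<close>

lemma nonneg_symmetric_diagonal:
  fixes d e :: "nat \<Rightarrow> real"
  assumes d: "\<And>i. i \<le> m \<Longrightarrow> 0 \<le> d i"
    and ed: "\<And>i. 1 \<le> i \<Longrightarrow> i \<le> m \<Longrightarrow> e i \<le> d i"
    and partial: "\<And>k. 1 \<le> k \<Longrightarrow> k \<le> m \<Longrightarrow> (\<Sum>i=1..k. d i) \<le> (\<Sum>i<k. e i)"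
    and total: "(\<Sum>i\<le>m. e i) = (\<Sum>i\<le>m. d i)"
  obtains M V where "perron_system {..m} 0 M e V" "\<And>i. i \<le> m \<Longrightarrow> M i i = d i"
proof -
  \<comment> \<open>The Perron root once \<open>k\<close>, ..., \<open>m\<close> are inserted: by
    \<open>total\<close> it equals \<open>d 0\<close> plus the sum of \<open>d i - e i\<close> over
    \<open>i\<close> from \<open>k\<close> to \<open>m\<close>.\<close>
  define s where "s k = (\<Sum>i<k. e i) - (\<Sum>i=1..<k. d i)" for k
  have "\<exists>M V. perron_system (insert 0 {k..m}) 0 M (e(0 := s k)) V \<and>
      (\<forall>i\<in>insert 0 {k..m}. M i i = d i)" if "1 \<le> k" "k \<le> m + 1" for k
    using that(2,1)
  proof (induction rule: inc_induct)
    case base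
    have "(\<Sum>i\<le>m. d i) = d 0 + (\<Sum>i=1..m. d i)"
      by (simp add: atMost_atLeast0 sum.atLeast_Suc_atMost)
    then have "s (m + 1) = d 0"
      using total by (simp add: s_def lessThan_Suc_atMost atLeastLessThanSuc_atLeastAtMost)
    then show ?case
      using d[of 0]
      by (intro exI[of _ "\<lambda>_ _. d 0"] exI[of _ "\<lambda>_ _. 1"])
        (auto simp: perron_system_def eigenbasis_def)
  next
    case (step k)
    then have k: "1 \<le> k" "k \<le> m" by auto
    obtain M V where MV: "perron_system (insert 0 {Suc k..m}) 0 M (e(0 := s (Suc k))) V"
      "\<And>i. i \<in> insert 0 {Suc k..m} \<Longrightarrow> M i i = d i"
      using step.IH[OF le_SucI[OF k(1)]] by blast
    \<comment> \<open>The bracket is nonnegative exactly by the partial sum condition at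
      \<open>k\<close>.\<close>
    have "s (Suc k) = e k + ((\<Sum>i<k. e i) - (\<Sum>i=1..k. d i))"
      by (simp add: s_def atLeastLessThanSuc_atLeastAtMost)
    then have "e k \<le> s (Suc k)"
      using partial[OF k] by simp
    then obtain M' V' where M': "perron_system (insert k (insert 0 {Suc k..m})) 0 M'
        ((e(0 := s (Suc k)))(0 := s (Suc k) + d k - e k, k := e k)) V'"
      "M' k k = d k" "\<And>x. x \<in> insert 0 {Suc k..m} \<Longrightarrow> M' x x = M x x"
      using perron_system_insert[OF _ _ _ MV(1), of k "e k" "d k"] k ed d by auto
    have "insert k (insert 0 {Suc k..m}) = insert 0 {k..m}"
      using k by auto
    moreover have "s (Suc k) + d k - e k = s k"
      using k by (simp add: s_def)
    then have "(e(0 := s (Suc k)))(0 := s (Suc k) + d k - e k, k := e k) = e(0 := s k)"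
      using k by auto
    ultimately have "perron_system (insert 0 {k..m}) 0 M' (e(0 := s k)) V'"
      using M'(1) by simp
    moreover have "M' i i = d i" if "i \<in> insert 0 {k..m}" for i
      using that M'(2,3) MV(2) by (cases "i = k") auto
    ultimately show ?case
      by blast
  qed
  from this[OF order_refl le_add2] obtain M V where "perron_system (insert 0 {1..m}) 0 M (e(0 := s 1)) V"
    "\<And>i. i \<in> insert 0 {1..m} \<Longrightarrow> M i i = d i"
    by blast
  moreover have "insert 0 {1..m} = {..m}"
    by auto
  \<comment> \<open>After the last bordering the Perron root is the remaining prescribed eigenvalue
    \<open>e 0\<close>.\<close>
  moreover have "e(0 := s 1) = e"
    by (auto simp: s_def)
  ultimately show ?thesis
    using that[of M V] by (metis atMost_iff)
qed

section \<open>Bisymmetric matrices from two symmetric blocks\<close>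

text \<open>Groups mirror positions. The monoid setting covers both the sums in
  \<open>eigenbasis\<close> and the product in the characteristic polynomial.\<close>

lemma (in comm_monoid_set) lessThan_fold_middle:
  fixes m :: nat
  shows "F g {..<2 * m + 2} = F (\<lambda>x. g (m - x) \<^bold>* g (m + 1 + x)) {..m}"
proof -
  have "F g {..m} = F (\<lambda>x. g (m - x)) {..m}"
    by (rule reindex_bij_witness[of _ "\<lambda>x. m - x" "\<lambda>x. m - x"]) auto
  moreover have "F g {m + 1..2 * m + 1} = F (\<lambda>x. g (m + 1 + x)) {..m}"
    by (rule reindex_bij_witness[of _ "\<lambda>x. m + 1 + x" "\<lambda>x. x - (m + 1)"]) auto
  moreover have "{..<2 * m + 2} = {..m} \<union> {m + 1..2 * m + 1}"
    by auto
  moreover have "F g ({..m} \<union> {m + 1..2 * m + 1}) = F g {..m} \<^bold>* F g {m + 1..2 * m + 1}"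
    by (rule union_disjoint) auto
  ultimately show ?thesis
    by (simp add: distrib)
qed

text \<open>Distributes the eigenvalues over the two blocks; the last index \<open>2 * m + 1\<close>
  is paired with \<open>0\<close>.\<close>

lemma (in comm_monoid_set) lessThan_pair_odd_even:
  fixes m :: nat
  shows "F g {..<2 * m + 2} = F (\<lambda>i. g (if i = 0 then 2 * m + 1 else 2 * i - 1) \<^bold>* g (2 * i)) {..m}"
proof -
  have "F g {..<2 * m + 1} = g 0 \<^bold>* F (\<lambda>i. g (2 * i - 1) \<^bold>* g (2 * i)) {1..m}"
    by (induction m) (simp_all add: ac_simps)
  moreover have "{..m} = insert 0 {1..m}"
    by auto
  ultimately show ?thesis
    by (simp add: ac_simps)
qed

definition fold_index :: "nat \<Rightarrow> nat \<Rightarrow> nat" where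
  "fold_index m p = (if p \<le> m then m - p else p - (m + 1))"

definition half_sign :: "nat \<Rightarrow> nat \<Rightarrow> real" where
  "half_sign m p = (if p \<le> m then - 1 else 1)"

text \<open>This is \<open>M\<close> on symmetric vectors and the diagonal matrix of \<nu> on
  antisymmetric ones, written in the standard basis. The factor 1/2 comes from normalising both
  kinds of basis vectors by \<open>sqrt 2\<close>.\<close>

definition bisym_fun :: "nat \<Rightarrow> (nat \<Rightarrow> nat \<Rightarrow> real) \<Rightarrow> (nat \<Rightarrow> real) \<Rightarrow> nat \<Rightarrow> nat \<Rightarrow> real" where
  "bisym_fun m M \<nu> p q = (M (fold_index m p) (fold_index m q) +
     half_sign m p * half_sign m q * (if fold_index m p = fold_index m q then \<nu> (fold_index m p) else 0)) / 2"

lemma fold_index_simps [simp]: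
  "x \<le> m \<Longrightarrow> fold_index m (m - x) = x" "fold_index m (Suc (m + x)) = x" "fold_index m (Suc (x + m)) = x"
  "x \<le> m \<Longrightarrow> half_sign m (m - x) = - 1" "half_sign m (Suc (m + x)) = 1" "half_sign m (Suc (x + m)) = 1"
  by (auto simp: fold_index_def half_sign_def)

text \<open>Indices up to \<open>m\<close> carry the antisymmetric unit vectors supported on one
  mirror pair, the others the symmetric extensions of the eigenvectors of \<open>M\<close>. Products
  of the two kinds cancel at mirror positions.\<close>

lemma eigenbasis_bisym_fun:
  assumes "eigenbasis {..m} M w V"
  shows "eigenbasis {..<2 * m + 2} (bisym_fun m M \<nu>)
    (\<lambda>p. if p \<le> m then \<nu> (fold_index m p) else w (fold_index m p))
    (\<lambda>p q. (if p \<le> m then half_sign m q * of_bool (fold_index m p = fold_index m q)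
            else V (fold_index m p) (fold_index m q)) / sqrt 2)"
    (is "eigenbasis _ ?Q ?w ?V")
proof -
  have fold_le: "fold_index m p \<le> m" if "p < 2 * m + 2" for p
    using that by (auto simp: fold_index_def)
  have orth: "(\<Sum>x\<le>m. V i x * V j x) = of_bool (i = j)" if "i \<le> m" "j \<le> m" for i j
    using assms that by (auto simp: eigenbasis_def)
  have eig: "(\<Sum>y\<le>m. M x y * V j y) = w j * V j x" if "j \<le> m" "x \<le> m" for j x
    using assms that by (auto simp: eigenbasis_def)
  have "(\<Sum>q<2 * m + 2. ?V i q * ?V j q) = of_bool (i = j)"
    if "i < 2 * m + 2" "j < 2 * m + 2" for i j
  proof -
    consider "i \<le> m" "j \<le> m" | "i \<le> m" "j > m" | "i > m" "j \<le> m" | "i > m" "j > m"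
      by linarith
    then show ?thesis
    proof cases
      case 1
      then have "(\<Sum>q<2 * m + 2. ?V i q * ?V j q) =
          (\<Sum>x\<le>m. of_bool (fold_index m i = x) * of_bool (fold_index m j = x))"
        unfolding sum.lessThan_fold_middle by (intro sum.cong) auto
      also have "\<dots> = of_bool (fold_index m i = fold_index m j)"
        using fold_le[OF that(1)] by (simp add: of_bool_def if_distrib[of "\<lambda>x. x * _"] cong: if_cong)
      also have "\<dots> = of_bool (i = j)"
        using 1 by (auto simp: fold_index_def)
      finally show ?thesis .
    next
      case 4
      then have "(\<Sum>q<2 * m + 2. ?V i q * ?V j q) =
          (\<Sum>x\<le>m. V (fold_index m i) x * V (fold_index m j) x)"
        unfolding sum.lessThan_fold_middle by (intro sum.cong) auto
      also have "\<dots> = of_bool (fold_index m i = fold_index m j)"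
        using that by (simp add: orth fold_le)
      also have "\<dots> = of_bool (i = j)"
        using 4 by (auto simp: fold_index_def)
      finally show ?thesis .
    next
      case 2
      then show ?thesis
        unfolding sum.lessThan_fold_middle by (auto intro!: sum.neutral)
    next
      case 3
      then show ?thesis
        unfolding sum.lessThan_fold_middle by (auto intro!: sum.neutral)
    qed
  qed
  moreover have "(\<Sum>q<2 * m + 2. ?Q p q * ?V j q) = ?w j * ?V j p"
    if "j < 2 * m + 2" "p < 2 * m + 2" for j p
  proof (cases "j \<le> m")
    case True
    define f where "f = fold_index m"
    \<comment> \<open>Over each mirror pair the \<open>M\<close> parts cancel and the \<nu> parts
      add up; for the symmetric vectors below it is the other way round.\<close>
    have "(\<Sum>q<2 * m + 2. ?Q p q * ?V j q) =
        (\<Sum>x\<le>m. half_sign m p * of_bool (f p = x) * \<nu> (f p) * of_bool (f j = x) / sqrt 2)"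
      unfolding sum.lessThan_fold_middle using True
      by (intro sum.cong) (auto simp: bisym_fun_def f_def field_simps)
    also have "\<dots> = (\<Sum>x\<le>m. if x = f p then
        half_sign m p * \<nu> (f p) * of_bool (f j = f p) / sqrt 2 else 0)"
      by (intro sum.cong) auto
    also have "\<dots> = ?w j * ?V j p"
      using True fold_le[OF that(2)] by (auto simp: f_def)
    finally show ?thesis .
  next
    case False
    then have "(\<Sum>q<2 * m + 2. ?Q p q * ?V j q) =
        (\<Sum>x\<le>m. M (fold_index m p) x * V (fold_index m j) x / sqrt 2)"
      unfolding sum.lessThan_fold_middle
      by (intro sum.cong) (auto simp: bisym_fun_def field_simps)
    also have "\<dots> = ?w j * ?V j p"
      using False that by (simp add: sum_divide_distrib[symmetric] eig fold_le)
    finally show ?thesis .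
  qed
  ultimately show ?thesis
    unfolding eigenbasis_def by blast
qed

lemma reverse_identity_conjugate:
  assumes "A \<in> carrier_mat n n"
  shows "reverse_identity_mat n * A * reverse_identity_mat n =
    mat n n (\<lambda>(i, j). A $$ (n - 1 - i, n - 1 - j))"
proof -
  have left: "(\<Sum>k<n. (if i + k + 1 = n then 1 else 0) * f k) = f (n - 1 - i)"
    if "i < n" for i and f :: "nat \<Rightarrow> real"
  proof -
    have "(\<Sum>k<n. (if i + k + 1 = n then 1 else 0) * f k) =
        (\<Sum>k<n. if k = n - 1 - i then f k else 0)"
      using that by (intro sum.cong) auto
    then show ?thesis
      using that by simp
  qed
  have right: "(\<Sum>k<n. f k * (if k + j + 1 = n then 1 else 0)) = f (n - 1 - j)"
    if "j < n" for j and f :: "nat \<Rightarrow> real"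
    using left[OF that, of f] by (simp add: mult.commute add.commute)
  show ?thesis
    using assms left right
    by (intro eq_matI)
      (auto simp: reverse_identity_mat_def scalar_prod_def lessThan_atLeast0)
qed

text \<open>Reflection of a position keeps \<open>fold_index\<close> and flips
  \<open>half_sign\<close>; the two sign changes in an entry cancel.\<close>

lemma bisymmetric_bisym_fun:
  assumes "\<And>x y. x \<le> m \<Longrightarrow> y \<le> m \<Longrightarrow> M x y = M y x"
  shows "bisymmetric_mat (mat (2 * m + 2) (2 * m + 2) (\<lambda>(p, q). bisym_fun m M \<nu> p q))"
    (is "bisymmetric_mat ?Q")
proof -
  have "bisym_fun m M \<nu> p q = bisym_fun m M \<nu> q p" if "p < 2 * m + 2" "q < 2 * m + 2" for p q
    using that assms[of "fold_index m p" "fold_index m q"]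
    by (auto simp: bisym_fun_def fold_index_def)
  then have "?Q\<^sup>T = ?Q"
    by (intro eq_matI) auto
  moreover have "fold_index m (2 * m + 1 - p) = fold_index m p"
    "half_sign m (2 * m + 1 - p) = - half_sign m p" if "p < 2 * m + 2" for p
    using that by (auto simp: fold_index_def half_sign_def)
  then have "reverse_identity_mat (2 * m + 2) * ?Q * reverse_identity_mat (2 * m + 2) = ?Q"
    by (subst reverse_identity_conjugate) (auto simp: bisym_fun_def intro!: eq_matI)
  ultimately show ?thesis
    by (simp add: bisymmetric_mat_def)
qed

section \<open>Choice of the two blocks for the given eigenvalues and diagonal\<close>

theorem theorem5p3:
  fixes m :: nat and l a :: "nat \<Rightarrow> real"
  assumes l_decreasing: "\<And>i j. i \<le> j \<Longrightarrow> j \<le> 2 * m + 1 \<Longrightarrow> l j \<le> l i"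
    and a_decreasing: "\<And>i j. 1 \<le> i \<Longrightarrow> i \<le> j \<Longrightarrow> j \<le> m \<Longrightarrow> a j \<le> a i"
    and a_nonneg: "\<And>i. i \<le> m \<Longrightarrow> 0 \<le> a i"
    and cond1: "\<And>i. 1 \<le> i \<Longrightarrow> i \<le> m \<Longrightarrow> l (2 * i - 1) \<le> a i"
    and cond2: "\<And>k. 1 \<le> k \<Longrightarrow> k \<le> 2 * m - 1 \<Longrightarrow>
      (\<Sum>i = 0..k. l i) \<ge>
        (\<Sum>i = 1..nat \<lceil>(real k + 1) / 2\<rceil>. a i) + (\<Sum>i = 1..nat \<lfloor>(real k + 1) / 2\<rfloor>. a i)"
    and cond3: "(\<Sum>i = 0..2 * m + 1. l i) = 2 * (\<Sum>i = 0..m. a i)"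
  shows "\<exists>Q \<in> carrier_mat (2 * m + 2) (2 * m + 2).
    nonnegative_mat Q \<and> bisymmetric_mat Q \<and>
    has_eigenvalues Q (map l [0..<2 * m + 2]) \<and>
    diag_mat Q = map a (rev [0..<m + 1]) @ map a [0..<m + 1]"
proof -
  define \<nu> where "\<nu> i = l (if i = 0 then 2 * m + 1 else 2 * i - 1)" for i
  define e where "e i = l (2 * i)" for i
  define d where "d i = 2 * a i - \<nu> i" for i
  \<comment> \<open>Condition (2) at index \<open>2 * k - 1\<close>, where ceiling and floor both
    equal \<open>k\<close>.\<close>
  have odd_partial: "2 * (\<Sum>i=1..k. a i) \<le> (\<Sum>i<2 * k. l i)" if "1 \<le> k" "k \<le> m" for k
  proof -
    have "real (2 * k - 1) + 1 = 2 * real k"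
      using that by (simp add: of_nat_diff)
    moreover have "{0..2 * k - 1} = {..<2 * k}"
      using that by auto
    ultimately show ?thesis
      using cond2[of "2 * k - 1"] that by simp
  qed
  have total: "(\<Sum>i<2 * m + 2. l i) = 2 * (\<Sum>i\<le>m. a i)"
    using cond3 by (simp add: lessThan_Suc_atMost atMost_atLeast0)
  have \<nu>a: "\<nu> i \<le> a i" if "i \<le> m" for i
  proof (cases "i = 0")
    case True
    \<comment> \<open>Subtracting this from the total leaves
      \<open>l (2 * m) + l (2 * m + 1)\<close> at most \<open>2 * a 0\<close>, so the smaller of the
      two is at most \<open>a 0\<close>. For \<open>m = 0\<close> both sums are empty.\<close>
    have "2 * (\<Sum>i=1..m. a i) \<le> (\<Sum>i<2 * m. l i)"
      using odd_partial[of m] by (cases "m = 0") auto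
    moreover have "(\<Sum>i<2 * m + 2. l i) = (\<Sum>i<2 * m. l i) + l (2 * m) + l (2 * m + 1)"
      by simp
    moreover have "(\<Sum>i\<le>m. a i) = a 0 + (\<Sum>i=1..m. a i)"
      by (simp add: atMost_atLeast0 sum.atLeast_Suc_atMost)
    moreover have "l (2 * m + 1) \<le> l (2 * m)"
      by (rule l_decreasing) auto
    ultimately show ?thesis
      using total True by (simp add: \<nu>_def)
  next
    case False
    then show ?thesis
      using cond1 that by (simp add: \<nu>_def)
  qed
  have d_nonneg: "0 \<le> d i" if "i \<le> m" for i
    using \<nu>a[OF that] a_nonneg[OF that] by (simp add: d_def)
  moreover have "e i \<le> d i" if "1 \<le> i" "i \<le> m" for i
  proof -
    have "e i \<le> \<nu> i"
      using that by (auto simp: e_def \<nu>_def intro!: l_decreasing)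
    then show ?thesis
      using \<nu>a[of i] that by (simp add: d_def)
  qed
  moreover have "(\<Sum>i=1..k. d i) \<le> (\<Sum>i<k. e i)" if "1 \<le> k" "k \<le> m" for k
  proof -
    \<comment> \<open>Moving the \<nu> terms across turns \<open>odd_partial\<close> into the
      condition on \<open>d\<close> and \<open>e\<close>.\<close>
    have "(\<Sum>i<2 * k. l i) = (\<Sum>i<k. e i) + (\<Sum>i=1..k. \<nu> i)"
      by (induction k) (auto simp: e_def \<nu>_def)
    then show ?thesis
      using odd_partial[OF that] by (simp add: d_def sum_subtractf sum_distrib_left)
  qed
  moreover have "(\<Sum>i\<le>m. e i) = (\<Sum>i\<le>m. d i)"
    using total sum.lessThan_pair_odd_even[of l m]
    by (simp add: d_def e_def \<nu>_def sum_subtractf sum_distrib_left sum.distrib)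
  ultimately obtain M V where MV: "perron_system {..m} 0 M e V" "\<And>i. i \<le> m \<Longrightarrow> M i i = d i"
    using nonneg_symmetric_diagonal[of m d e] by blast
  have M: "M x y = M y x" "0 \<le> M x y" if "x \<le> m" "y \<le> m" for x y
    using MV(1) that by (auto simp: perron_system_def)
  define Q where "Q = mat (2 * m + 2) (2 * m + 2) (\<lambda>(p, q). bisym_fun m M \<nu> p q)"
  have carrier: "Q \<in> carrier_mat (2 * m + 2) (2 * m + 2)"
    by (simp add: Q_def)
  have nonneg: "0 \<le> bisym_fun m M \<nu> p q" if "p < 2 * m + 2" "q < 2 * m + 2" for p q
  proof -
    define x y where "x = fold_index m p" and "y = fold_index m q"
    have xy: "x \<le> m" "y \<le> m"
      using that by (auto simp: x_def y_def fold_index_def)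
    \<comment> \<open>Since \<open>M x x = 2 * a x - \<nu> x\<close>, the upper bound is
      \<open>\<nu> x \<le> a x\<close> and the lower one is \<open>0 \<le> a x\<close>. Entries with
      \<open>x\<close> different from \<open>y\<close> are just \<open>M x y / 2\<close>.\<close>
    have "\<bar>\<nu> x\<bar> \<le> M x x"
      using \<nu>a[of x] a_nonneg[of x] MV(2)[of x] xy by (auto simp: d_def)
    then show ?thesis
      using M(2)[OF xy]
      by (auto simp: bisym_fun_def x_def[symmetric] y_def[symmetric] half_sign_def)
  qed
  then have "nonnegative_mat Q"
    by (auto simp: nonnegative_mat_def elements_mat_def Q_def)
  moreover have "bisymmetric_mat Q"
    unfolding Q_def using M(1) by (rule bisymmetric_bisym_fun)
  moreover have "has_eigenvalues Q (map l [0..<2 * m + 2])"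
  proof -
    have "eigenbasis {..m} M e V"
      using MV(1) by (simp add: perron_system_def)
    from char_poly_eigenbasis[OF eigenbasis_bisym_fun[OF this, of \<nu>]]
    have "char_poly Q = (\<Prod>x\<le>m. [:- \<nu> x, 1:] * [:- e x, 1:])"
      unfolding Q_def prod.lessThan_fold_middle by simp
    also have "\<dots> = (\<Prod>i<2 * m + 2. [:- l i, 1:])"
      unfolding prod.lessThan_pair_odd_even \<nu>_def e_def ..
    also have "\<dots> = (\<Prod>x\<leftarrow>map l [0..<2 * m + 2]. [:- x, 1:])"
      by (simp add: prod.distinct_set_conv_list[symmetric] comp_def lessThan_atLeast0 del: upt_Suc)
    finally show ?thesis
      using carrier by (simp add: has_eigenvalues_def)
  qed
  moreover have "diag_mat Q = map a (rev [0..<m + 1]) @ map a [0..<m + 1]"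
  proof -
    have "bisym_fun m M \<nu> p p = a (fold_index m p)" if "p < 2 * m + 2" for p
      using that MV(2)[of "fold_index m p"]
      by (auto simp: bisym_fun_def d_def fold_index_def half_sign_def)
    then show ?thesis
      by (intro nth_equalityI)
        (auto simp: diag_mat_def Q_def nth_append rev_nth fold_index_def simp del: upt_Suc)
  qed
  ultimately show ?thesis
    using carrier by blast
qed

end
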